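(* Let $q$ be a prime power and $2\le d\le q$. The number of words having weight $d$ of the corner code $\mathsf{H}^{0}_d$ is $$A_d=q^2(q^2-1)\binom{q}{d-1}\frac{q^3-d+1}{d}.$$
   Context: Let $\mathcal{H}$ be the Hermitian curve $x^{q+1}=y^q+y$ over $\mathbb{F}_{q^2}$, with its $n=q^3$ affine $\mathbb{F}_{q^2}$-rational points $P_1,\dots,P_n$. For an integer $m$ let $\mathcal{B}_{m,q}=\{x^ry^s : qr+(q+1)s\le m,\ 0\le s\le q-1,\ 0\le r\le q^2-1\}$, and let the Hermitian code $C(m,q)$ be the set of $c\in(\mathbb{F}_{q^2})^n$ with $\sum_{i=1}^n c_i f(P_i)=0$ for all $f\in\mathcal{B}_{m,q}$. For $2\le d\le q$, the corner code $\mathsf{H}^{0}_d$ is the Hermitian code $C(m,q)$ for which $\mathcal{B}_{m,q}=\{x^ry^s: r,s\ge 0,\ r+s\le d-2\}$. It has minimum distance $d$. *)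

theory Defs
  imports
    "HOL-Library.FuncSet"
    "HOL-Library.Cardinality"
    "HOL-Computational_Algebra.Polynomial"
    "HOL-Number_Theory.Prime_Powers"
begin

definition hermitian_points :: "nat \<Rightarrow> ('a::field \<times> 'a) set" where
  "hermitian_points q = {(x, y). x ^ (q + 1) = y ^ q + y}"

text \<open>
  A bivariate polynomial over \<^typ>\<open>'a\<close> is an element of \<^typ>\<open>'a::zero poly poly\<close>: a polynomial
  in \<open>y\<close> whose coefficients are polynomials in \<open>x\<close>.
\<close>

definition xy_monom :: "nat \<Rightarrow> nat \<Rightarrow> 'a::comm_semiring_1 poly poly" where
  "xy_monom r s = monom (monom 1 r) s"

definition eval_at :: "'a::comm_semiring_1 poly poly \<Rightarrow> 'a \<times> 'a \<Rightarrow> 'a" where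
  "eval_at f p = poly (poly f [:snd p:]) (fst p)"

definition monomial_basis :: "int \<Rightarrow> nat \<Rightarrow> 'a::comm_semiring_1 poly poly set" where
  "monomial_basis m q =
     {xy_monom r s | r s.
        int q * int r + (int q + 1) * int s \<le> m \<and> s \<le> q - 1 \<and> r \<le> q\<^sup>2 - 1}"

text \<open>
  The points of the curve are listed as \<open>P 1, \<dots>, P n\<close>. A word of length \<open>n\<close> is an extensional
  function on \<open>{1..n}\<close>, so that distinct functions are distinct words.
\<close>

definition hermitian_code ::
  "nat \<Rightarrow> (nat \<Rightarrow> 'a::field \<times> 'a) \<Rightarrow> int \<Rightarrow> nat \<Rightarrow> (nat \<Rightarrow> 'a) set" where
  "hermitian_code n P m q =
     {c \<in> {1..n} \<rightarrow>\<^sub>E UNIV. \<forall>f \<in> monomial_basis m q. (\<Sum>i = 1..n. c i * eval_at f (P i)) = 0}"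

text \<open>
  Several \<open>m\<close> may give the same set of monomials, but they all give the same code, so the
  description is over codes rather than over \<open>m\<close>. It is used for \<open>2 \<le> d \<le> q\<close> only, so the
  subtraction \<open>d - 2\<close> is never truncated.
\<close>

definition corner_code ::
  "nat \<Rightarrow> (nat \<Rightarrow> 'a::field \<times> 'a) \<Rightarrow> nat \<Rightarrow> nat \<Rightarrow> (nat \<Rightarrow> 'a) set" where
  "corner_code n P q d =
     (THE C. \<exists>m. (monomial_basis m q :: 'a poly poly set) = {xy_monom r s | r s. r + s \<le> d - 2}
               \<and> C = hermitian_code n P m q)"

definition weight :: "nat \<Rightarrow> (nat \<Rightarrow> 'a::zero) \<Rightarrow> nat" where
  "weight n c = card {i \<in> {1..n}. c i \<noteq> 0}"

end

theory Submission
  imports Defs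
begin

text \<open>
  The support of a word of weight \<open>d\<close> consists of \<open>d\<close> points whose evaluations of polynomials of
  degree at most \<open>d - 2\<close> satisfy a linear relation with no zero coefficient. This forces the points
  to be collinear. Conversely \<open>d\<close> points on a line admit exactly one such relation up to scalars, so
  every collinear \<open>d\<close>-subset of the curve supports \<open>q^2 - 1\<close> words. The \<open>q^2\<close> vertical lines meet the
  curve in \<open>q\<close> points each, because the trace is \<open>q\<close>-to-one; of the other \<open>q^4\<close> lines \<open>q^3\<close> are tangents
  with one point, and the rest have \<open>q + 1\<close> points, because the norm is \<open>(q + 1)\<close>-to-one on units.
  Two lines share at most one point and \<open>d > 1\<close>, so the collinear \<open>d\<close>-subsets number
  \<open>q^2 (q choose d) + (q^4 - q^3) (q + 1 choose d)\<close>.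
\<close>

section \<open>Linear dependencies of polynomial evaluations\<close>

text \<open>
  Lagrange interpolation at \<open>k + 2\<close> points reproduces polynomials of degree at most \<open>k + 1\<close>, and for
  degree at most \<open>k\<close> the coefficient of degree \<open>k + 1\<close> of the interpolant vanishes.
\<close>

lemma lagrange_weights:
  fixes u :: "'i \<Rightarrow> 'a::field"
  assumes "finite S" and inj: "inj_on u S" and card: "card S = Suc (Suc k)"
  obtains w where "\<And>i. i \<in> S \<Longrightarrow> w i \<noteq> 0"
    and "\<And>f. degree f \<le> k \<Longrightarrow> (\<Sum>i\<in>S. w i * poly f (u i)) = 0"
proof -
  define N where "N i = (\<Prod>j\<in>S - {i}. [:- u j, 1:])" for i
  define w where "w i = inverse (poly (N i) (u i))" for i
  have N_nz: "poly (N i) (u i) \<noteq> 0" if "i \<in> S" for i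
    using that inj \<open>finite S\<close> by (auto simp: N_def poly_prod inj_on_def)
  have N_z: "poly (N i) (u j) = 0" if "j \<in> S" "j \<noteq> i" for i j
    using that \<open>finite S\<close> by (auto simp: N_def poly_prod)
  have N_deg: "degree (N i) = Suc k" if "i \<in> S" for i
    unfolding N_def using that card \<open>finite S\<close> by (subst degree_prod_eq_sum_degree) auto
  have N_lead: "coeff (N i) (Suc k) = 1" if "i \<in> S" for i
    using lead_coeff_prod[of "\<lambda>j. [:- u j, 1:]" "S - {i}"] N_deg[OF that] by (simp add: N_def)
  have "(\<Sum>i\<in>S. w i * poly f (u i)) = 0" if f: "degree f \<le> k" for f
  proof -
    define g where "g = (\<Sum>i\<in>S. smult (w i * poly f (u i)) (N i))"
    have "poly g (u i) = poly f (u i)" if i: "i \<in> S" for i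
    proof -
      have "poly g (u i) = (\<Sum>j\<in>S. w j * poly f (u j) * poly (N j) (u i))"
        by (simp add: g_def poly_sum)
      also have "\<dots> = (\<Sum>j\<in>S. if j = i then w i * poly f (u i) * poly (N i) (u i) else 0)"
        by (intro sum.cong) (auto simp: N_z i)
      also have "\<dots> = poly f (u i)"
        using N_nz[OF i] i \<open>finite S\<close> by (simp add: w_def)
      finally show ?thesis .
    qed
    hence roots: "u ` S \<subseteq> {x. poly (g - f) x = 0}" by auto
    have deg: "degree (g - f) \<le> Suc k"
      unfolding g_def using f N_deg
      by (intro degree_diff_le degree_sum_le \<open>finite S\<close>) (auto intro: degree_smult_le[THEN order_trans])
    have "g - f = 0"
    proof (rule ccontr)
      assume nz: "g - f \<noteq> 0"
      have "card S \<le> card {x. poly (g - f) x = 0}"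
        using card_mono[OF poly_roots_finite[OF nz] roots] card_image[OF inj] by simp
      with card_poly_roots_bound[OF nz] deg card show False by simp
    qed
    hence "coeff g (Suc k) = 0"
      using f by (simp add: coeff_eq_0)
    moreover have "coeff g (Suc k) = (\<Sum>i\<in>S. w i * poly f (u i))"
      unfolding g_def by (simp add: coeff_sum N_lead)
    ultimately show ?thesis by simp
  qed
  moreover have "w i \<noteq> 0" if "i \<in> S" for i
    using N_nz[OF that] by (simp add: w_def)
  ultimately show thesis using that by blast
qed

lemma power_sums_zero_imp_poly_sum_zero:
  fixes u :: "'i \<Rightarrow> 'a::comm_ring_1"
  assumes "\<And>j. j \<le> k \<Longrightarrow> (\<Sum>i\<in>S. c i * u i ^ j) = 0" and "degree f \<le> k"
  shows "(\<Sum>i\<in>S. c i * poly f (u i)) = 0"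
proof -
  have "(\<Sum>i\<in>S. c i * poly f (u i)) = (\<Sum>i\<in>S. \<Sum>j\<le>degree f. coeff f j * (c i * u i ^ j))"
    by (simp add: poly_altdef sum_distrib_left algebra_simps)
  also have "\<dots> = (\<Sum>j\<le>degree f. coeff f j * (\<Sum>i\<in>S. c i * u i ^ j))"
    by (subst sum.swap) (simp add: sum_distrib_left)
  also have "\<dots> = 0"
    using assms by (intro sum.neutral) auto
  finally show ?thesis .
qed

text \<open>The solutions \<open>c\<close> form a line spanned by the Lagrange weights: a solution
  that vanishes at one index vanishes everywhere, so subtracting the multiple of \<open>w\<close>
  that agrees with \<open>c\<close> at \<open>i0\<close> leaves zero.\<close>

lemma power_sums_zero_iff:
  fixes u :: "'i \<Rightarrow> 'a::field"
  assumes "finite S" and inj: "inj_on u S" and card: "card S = Suc (Suc k)"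
  obtains w where "\<And>i. i \<in> S \<Longrightarrow> w i \<noteq> 0"
    and "\<And>c. (\<forall>j\<le>k. (\<Sum>i\<in>S. c i * u i ^ j) = 0) \<longleftrightarrow> (\<exists>l. \<forall>i\<in>S. c i = l * w i)"
proof -
  obtain w where w: "\<And>i. i \<in> S \<Longrightarrow> w i \<noteq> 0"
    and w0: "\<And>f. degree f \<le> k \<Longrightarrow> (\<Sum>i\<in>S. w i * poly f (u i)) = 0"
    using lagrange_weights[OF assms] by metis
  have w1: "(\<Sum>i\<in>S. w i * u i ^ j) = 0" if "j \<le> k" for j
    using w0[of "monom 1 j"] that by (simp add: poly_monom degree_monom_eq)
  obtain i0 where i0: "i0 \<in> S" using card by fastforce
  have vanish: "c i = 0" if c: "\<forall>j\<le>k. (\<Sum>i\<in>S. c i * u i ^ j) = 0" and "c i0 = 0" and i: "i \<in> S"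
    for c i
  proof (cases "i = i0")
    case False
    \<comment> \<open>This product has \<open>k\<close> factors and kills every node except those of
      \<open>i\<close> and \<open>i0\<close>. Since \<open>c i0 = 0\<close>, the relation for
      \<open>f\<close> isolates \<open>c i\<close>.\<close>
    define f where "f = (\<Prod>j\<in>S - {i, i0}. [:- u j, 1:])"
    have "degree f \<le> k"
      unfolding f_def using i i0 False \<open>finite S\<close> card
      by (subst degree_prod_eq_sum_degree) auto
    hence "0 = (\<Sum>j\<in>S. c j * poly f (u j))"
      using power_sums_zero_imp_poly_sum_zero[of k c u S f] c by simp
    also have "\<dots> = (\<Sum>j\<in>S. if j = i then c i * poly f (u i) else 0)"
      using \<open>c i0 = 0\<close> \<open>finite S\<close> by (intro sum.cong) (auto simp: f_def poly_prod)
    also have "\<dots> = c i * poly f (u i)"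
      using i \<open>finite S\<close> by simp
    finally have "c i * poly f (u i) = 0" by simp
    moreover have "poly f (u i) \<noteq> 0"
      using i inj \<open>finite S\<close> by (auto simp: f_def poly_prod inj_on_def)
    ultimately show ?thesis by simp
  qed (use that in simp)
  have "\<exists>l. \<forall>i\<in>S. c i = l * w i" if c: "\<forall>j\<le>k. (\<Sum>i\<in>S. c i * u i ^ j) = 0" for c
  proof -
    define l where "l = c i0 / w i0"
    have "\<forall>j\<le>k. (\<Sum>i\<in>S. (c i - l * w i) * u i ^ j) = 0"
      using c w1 by (simp add: left_diff_distrib sum_subtractf mult.assoc flip: sum_distrib_left)
    moreover have "c i0 - l * w i0 = 0" using w[OF i0] by (simp add: l_def)
    ultimately have "c i - l * w i = 0" if "i \<in> S" for i
      using vanish[of "\<lambda>i. c i - l * w i" i] that by blast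
    thus ?thesis by (intro exI[of _ l]) simp
  qed
  moreover have "\<forall>j\<le>k. (\<Sum>i\<in>S. c i * u i ^ j) = 0" if "\<forall>i\<in>S. c i = l * w i" for c l
    using that w1 by (simp add: mult.assoc flip: sum_distrib_left)
  ultimately show thesis using that[of w] w by blast
qed

section \<open>Lines of the affine plane\<close>

definition vertical_line :: "'a \<Rightarrow> ('a \<times> 'a) set" where
  "vertical_line a = {p. fst p = a}"

definition sloped_line :: "'a::semiring \<times> 'a \<Rightarrow> ('a \<times> 'a) set" where
  "sloped_line be = {p. snd p = fst be * fst p + snd be}"

text \<open>Each family is parametrized injectively and the two are disjoint, which turns sums over
  lines into sums over \<open>a\<close> and over pairs of slope and intercept.\<close>

definition affine_lines :: "('a::semiring \<times> 'a) set set" where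
  "affine_lines = range vertical_line \<union> range sloped_line"

lemma inj_vertical_line: "inj vertical_line"
proof (rule injI)
  fix a b :: 'a
  assume eq: "vertical_line a = vertical_line b"
  have "(a, a) \<in> vertical_line a" by (simp add: vertical_line_def)
  thus "a = b" unfolding eq by (simp add: vertical_line_def)
qed

lemma inj_sloped_line: "inj (sloped_line :: 'a::comm_ring_1 \<times> 'a \<Rightarrow> _)"
proof (rule injI)
  fix l l' :: "'a \<times> 'a"
  assume eq: "sloped_line l = sloped_line l'"
  \<comment> \<open>The points over 0 and 1 recover the intercept and then the slope.\<close>
  have "(0, snd l) \<in> sloped_line l" "(1, fst l + snd l) \<in> sloped_line l"
    by (simp_all add: sloped_line_def)
  hence "(0, snd l) \<in> sloped_line l'" "(1, fst l + snd l) \<in> sloped_line l'"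
    using eq by auto
  thus "l = l'" by (auto simp: sloped_line_def prod_eq_iff)
qed

lemma vertical_line_neq_sloped_line: "vertical_line a \<noteq> sloped_line (l :: 'a::comm_ring_1 \<times> 'a)"
proof
  assume eq: "vertical_line a = sloped_line l"
  have "(a, y) \<in> vertical_line a" for y by (simp add: vertical_line_def)
  hence "y = fst l * a + snd l" for y using eq by (auto simp: sloped_line_def)
  from this[of 0] this[of 1] show False by simp
qed

lemma affine_line_through:
  fixes p p' :: "'a::field \<times> 'a"
  assumes "p \<noteq> p'"
  shows "\<exists>L\<in>affine_lines. p \<in> L \<and> p' \<in> L"
proof (cases "fst p = fst p'")
  case True
  hence "p \<in> vertical_line (fst p)" "p' \<in> vertical_line (fst p)"
    by (auto simp: vertical_line_def)
  thus ?thesis by (auto simp: affine_lines_def)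
next
  case False
  define b where "b = (snd p' - snd p) / (fst p' - fst p)"
  have b: "b * (fst p' - fst p) = snd p' - snd p" using False by (simp add: b_def)
  have "p \<in> sloped_line (b, snd p - b * fst p)" "p' \<in> sloped_line (b, snd p - b * fst p)"
    using b by (auto simp: sloped_line_def algebra_simps)
  thus ?thesis by (auto simp: affine_lines_def)
qed

text \<open>Needed so that a set of at least two points is counted for at most one line.\<close>

lemma affine_line_unique:
  fixes p p' :: "'a::field \<times> 'a"
  assumes L: "L \<in> affine_lines" "L' \<in> affine_lines"
    and p: "p \<in> L" "p' \<in> L" "p \<in> L'" "p' \<in> L'" "p \<noteq> p'"
  shows "L = L'"
proof (cases "fst p = fst p'")
  case True
  have "M = vertical_line (fst p)" if "M \<in> affine_lines" "p \<in> M" "p' \<in> M" for M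
    using that True \<open>p \<noteq> p'\<close>
    by (auto simp: affine_lines_def vertical_line_def sloped_line_def prod_eq_iff)
  thus ?thesis using L p by blast
next
  case False
  define b where "b = (snd p' - snd p) / (fst p' - fst p)"
  have "M = sloped_line (b, snd p - b * fst p)" if M: "M \<in> affine_lines" "p \<in> M" "p' \<in> M" for M
  proof -
    obtain l where l: "M = sloped_line l"
      using M False by (auto simp: affine_lines_def vertical_line_def)
    have "snd p = fst l * fst p + snd l" "snd p' = fst l * fst p' + snd l"
      using M by (auto simp: l sloped_line_def)
    hence "fst l = b" "snd l = snd p - b * fst p"
      using False by (auto simp: b_def field_simps)
    thus ?thesis using l by (metis prod.collapse)
  qed
  thus ?thesis using L p by blast
qed

definition affine_form :: "('a::comm_ring_1 \<times> 'a \<Rightarrow> 'a) \<Rightarrow> bool" where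
  "affine_form g \<longleftrightarrow> (\<exists>a b e. \<forall>p. g p = a * fst p + b * snd p + e)"

lemma affine_line_form:
  assumes "L \<in> affine_lines"
  obtains g :: "'a::comm_ring_1 \<times> 'a \<Rightarrow> 'a" where "affine_form g" and "\<And>p. g p = 0 \<longleftrightarrow> p \<in> L"
proof -
  consider a where "L = vertical_line a" | b e where "L = sloped_line (b, e)"
    using assms by (auto simp: affine_lines_def)
  thus thesis
  proof cases
    case (1 a)
    have "affine_form (\<lambda>p. fst p - a)"
      unfolding affine_form_def by (intro exI[of _ 1] exI[of _ 0] exI[of _ "-a"]) simp
    thus thesis using that 1 by (simp add: vertical_line_def)
  next
    case (2 b e)
    have "affine_form (\<lambda>p. snd p - (b * fst p + e))"
      unfolding affine_form_def by (intro exI[of _ "-b"] exI[of _ 1] exI[of _ "-e"]) simp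
    thus thesis using that 2 by (simp add: sloped_line_def)
  qed
qed

text \<open>The horizontal line through \<open>p\<close> avoids \<open>p'\<close> when the
  x-coordinates agree, and the vertical one does otherwise.\<close>

lemma affine_form_separates:
  fixes p p' :: "'a::comm_ring_1 \<times> 'a"
  assumes "p \<noteq> p'"
  obtains g where "affine_form g" and "g p = 0" and "g p' \<noteq> 0"
proof (cases "fst p = fst p'")
  case True
  have "affine_form (\<lambda>x. snd x - snd p)"
    unfolding affine_form_def by (intro exI[of _ 0] exI[of _ 1] exI[of _ "- snd p"]) simp
  thus thesis using that True assms by (auto simp: prod_eq_iff)
next
  case False
  have "affine_form (\<lambda>x. fst x - fst p)"
    unfolding affine_form_def by (intro exI[of _ 1] exI[of _ 0] exI[of _ "- fst p"]) simp
  thus thesis using that False by (auto simp: prod_eq_iff)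
qed

text \<open>Each affine factor uses up one unit of the degree bound \<open>k\<close>. Expanding one
  factor gives three sums with a smaller product and exponents raised by at most one; the spare
  monomial with exponents \<open>r\<close> and \<open>s\<close> absorbs this in the
  induction.\<close>

lemma moments_zero_imp_affine_prod_zero:
  fixes P :: "'i \<Rightarrow> 'a::comm_ring_1 \<times> 'a"
  assumes mom: "\<And>r s. r + s \<le> k \<Longrightarrow> (\<Sum>i\<in>S. c i * (fst (P i) ^ r * snd (P i) ^ s)) = 0"
    and "finite J" and "\<And>j. j \<in> J \<Longrightarrow> affine_form (g j)" and "card J + r + s \<le> k"
  shows "(\<Sum>i\<in>S. c i * (fst (P i) ^ r * snd (P i) ^ s * (\<Prod>j\<in>J. g j (P i)))) = 0"
  using assms(2-4)
proof (induction J arbitrary: r s rule: finite_induct)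
  case empty
  thus ?case using mom by simp
next
  case (insert j J)
  define G where "G i = (\<Prod>j\<in>J. g j (P i))" for i
  obtain a b e where g: "\<And>p. g j p = a * fst p + b * snd p + e"
    using insert.prems(1)[of j] by (auto simp: affine_form_def)
  have IH: "(\<Sum>i\<in>S. c i * (fst (P i) ^ r' * snd (P i) ^ s' * G i)) = 0"
    if "card J + r' + s' \<le> k" for r' s'
    unfolding G_def using insert.IH[of r' s'] insert.prems that by simp
  have "(\<Sum>i\<in>S. c i * (fst (P i) ^ r * snd (P i) ^ s * (\<Prod>j\<in>insert j J. g j (P i)))) =
      (\<Sum>i\<in>S. a * (c i * (fst (P i) ^ Suc r * snd (P i) ^ s * G i)) +
        b * (c i * (fst (P i) ^ r * snd (P i) ^ Suc s * G i)) +
        e * (c i * (fst (P i) ^ r * snd (P i) ^ s * G i)))"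
    using insert.hyps by (intro sum.cong) (simp_all add: G_def g algebra_simps)
  also have "\<dots> = 0"
    unfolding sum.distrib sum_distrib_left[symmetric]
    using insert.prems(2) insert.hyps by (simp add: IH del: power_Suc)
  finally show ?case .
qed

text \<open>
  If three of the points are not collinear, the line through two of them and one line through each
  of the others, all avoiding the third point, form a curve of degree \<open>k\<close> that misses only the third
  point, whose coefficient must therefore vanish.
\<close>

lemma moments_zero_imp_collinear:
  fixes P :: "'i \<Rightarrow> 'a::field \<times> 'a"
  assumes mom: "\<And>r s. r + s \<le> k \<Longrightarrow> (\<Sum>i\<in>S. c i * (fst (P i) ^ r * snd (P i) ^ s)) = 0"
    and "finite S" and inj: "inj_on P S" and card: "card S = Suc (Suc k)"
    and nz: "\<And>i. i \<in> S \<Longrightarrow> c i \<noteq> 0"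
  shows "\<exists>L\<in>affine_lines. P ` S \<subseteq> L"
proof -
  obtain i1 where i1: "i1 \<in> S" using card by fastforce
  obtain i2 where i2: "i2 \<in> S" "i2 \<noteq> i1"
    using card i1 by (metis card_Suc_eq insert_iff)
  obtain L where L: "L \<in> affine_lines" "P i1 \<in> L" "P i2 \<in> L"
    using affine_line_through[of "P i1" "P i2"] i1 i2 inj by (auto simp: inj_on_def)
  have "P i3 \<in> L" if i3: "i3 \<in> S" for i3
  proof (rule ccontr)
    assume notin: "P i3 \<notin> L"
    hence neq: "i3 \<noteq> i1" "i3 \<noteq> i2" using L by auto
    obtain g0 where g0: "affine_form g0" "\<And>p. g0 p = 0 \<longleftrightarrow> p \<in> L"
      using affine_line_form[OF L(1)] by metis
    have "\<exists>g. affine_form g \<and> g (P j) = 0 \<and> g (P i3) \<noteq> 0" if "j \<in> S - {i3}" for j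
      using affine_form_separates[of "P j" "P i3"] that i3 inj by (auto simp: inj_on_def) metis
    then obtain g where g: "\<And>j. j \<in> S - {i3} \<Longrightarrow> affine_form (g j) \<and> g j (P j) = 0 \<and> g j (P i3) \<noteq> 0"
      by metis
    \<comment> \<open>The form of \<open>i1\<close> is replaced by that of the line
      \<open>L\<close>, which also passes through \<open>P i2\<close>. Hence \<open>i2\<close> needs
      no form of its own, and exactly \<open>k\<close> factors remain.\<close>
    define h where "h = g(i1 := g0)"
    define J where "J = S - {i2, i3}"
    have J: "finite J" "card J = k" "i1 \<in> J"
      using \<open>finite S\<close> card i1 i2 i3 neq by (auto simp: J_def card_Diff_subset)
    have h_form: "affine_form (h j)" if "j \<in> J" for j
      using that g g0(1) by (auto simp: h_def J_def)
    have "(\<Sum>i\<in>S. c i * (fst (P i) ^ 0 * snd (P i) ^ 0 * (\<Prod>j\<in>J. h j (P i)))) = 0"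
      using mom J by (intro moments_zero_imp_affine_prod_zero[where k = k] h_form) auto
    moreover have "(\<Prod>j\<in>J. h j (P i)) = 0" if "i \<in> S" "i \<noteq> i3" for i
    proof -
      have "\<exists>j\<in>J. h j (P i) = 0"
      proof (cases "i = i2")
        case True
        thus ?thesis using J(3) g0(2) L(3) by (intro bexI[of _ i1]) (auto simp: h_def)
      next
        case False
        thus ?thesis using that g g0(2) L(2) by (intro bexI[of _ i]) (auto simp: h_def J_def)
      qed
      thus ?thesis using J(1) by simp
    qed
    hence "(\<Sum>i\<in>S. c i * (fst (P i) ^ 0 * snd (P i) ^ 0 * (\<Prod>j\<in>J. h j (P i)))) =
        (\<Sum>i\<in>S. if i = i3 then c i3 * (\<Prod>j\<in>J. h j (P i3)) else 0)"
      by (intro sum.cong) auto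
    ultimately have "c i3 * (\<Prod>j\<in>J. h j (P i3)) = 0"
      using i3 \<open>finite S\<close> by simp
    moreover have "h j (P i3) \<noteq> 0" if "j \<in> J" for j
      using that g g0(2) notin by (auto simp: h_def J_def)
    ultimately show False using nz[OF i3] J(1) by simp
  qed
  thus ?thesis using L(1) by blast
qed

text \<open>On a line, polynomials of degree at most \<open>k\<close> in two variables restrict to
  those of degree at most \<open>k\<close> in one coordinate \<open>u\<close>. The moment conditions
  thus become power sum conditions at distinct nodes.\<close>

lemma collinear_moments_zero_iff:
  fixes P :: "'i \<Rightarrow> 'a::field \<times> 'a"
  assumes "finite S" and inj: "inj_on P S" and card: "card S = Suc (Suc k)"
    and L: "L \<in> affine_lines" "P ` S \<subseteq> L"
  obtains w where "\<And>i. i \<in> S \<Longrightarrow> w i \<noteq> 0"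
    and "\<And>c. (\<forall>r s. r + s \<le> k \<longrightarrow> (\<Sum>i\<in>S. c i * (fst (P i) ^ r * snd (P i) ^ s)) = 0)
              \<longleftrightarrow> (\<exists>l. \<forall>i\<in>S. c i = l * w i)"
proof -
  consider a where "L = vertical_line a" | b e where "L = sloped_line (b, e)"
    using L by (auto simp: affine_lines_def)
  hence "\<exists>u. inj_on u S \<and> (\<forall>c. (\<forall>r s. r + s \<le> k \<longrightarrow> (\<Sum>i\<in>S. c i * (fst (P i) ^ r * snd (P i) ^ s)) = 0)
      \<longleftrightarrow> (\<forall>j\<le>k. (\<Sum>i\<in>S. c i * u i ^ j) = 0))"
  proof cases
    case (1 a)
    hence x: "fst (P i) = a" if "i \<in> S" for i using that L by (auto simp: vertical_line_def)
    have "inj_on (\<lambda>i. snd (P i)) S"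
      using inj x by (auto simp: inj_on_def prod_eq_iff)
    moreover have "(\<Sum>i\<in>S. c i * (fst (P i) ^ r * snd (P i) ^ s)) =
        a ^ r * (\<Sum>i\<in>S. c i * snd (P i) ^ s)" for c r s
      unfolding sum_distrib_left by (intro sum.cong) (auto simp: x)
    ultimately show ?thesis
      \<comment> \<open>For the converse implication the moments with \<open>r = 0\<close> already
        give all power sums.\<close>
      by (intro exI[of _ "\<lambda>i. snd (P i)"]) (force dest: spec[of _ 0])
  next
    case (2 b e)
    hence y: "snd (P i) = b * fst (P i) + e" if "i \<in> S" for i
      using that L by (auto simp: sloped_line_def)
    have "inj_on (\<lambda>i. fst (P i)) S"
      using inj y by (auto simp: inj_on_def prod_eq_iff)
    moreover have "(\<forall>r s. r + s \<le> k \<longrightarrow> (\<Sum>i\<in>S. c i * (fst (P i) ^ r * snd (P i) ^ s)) = 0)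
      \<longleftrightarrow> (\<forall>j\<le>k. (\<Sum>i\<in>S. c i * fst (P i) ^ j) = 0)" (is "?A \<longleftrightarrow> ?B") for c
    proof
      assume ?A
      hence "(\<Sum>i\<in>S. c i * (fst (P i) ^ j * snd (P i) ^ 0)) = 0" if "j \<le> k" for j
        using that by (metis add.right_neutral)
      thus ?B by simp
    next
      assume B: ?B
      show ?A
      proof (intro allI impI)
        fix r s assume rs: "r + s \<le> k"
        \<comment> \<open>This is the restriction of \<open>x^r * y^s\<close> to the line, written
          in the coordinate \<open>x\<close>.\<close>
        define f where "f = monom 1 r * [:e, b:] ^ s"
        have "degree f \<le> r + s * 1"
          unfolding f_def
          by (intro degree_mult_le[THEN order_trans] add_mono degree_monom_le
              degree_power_le[THEN order_trans]) (simp add: degree_pCons_le)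
        hence "(\<Sum>i\<in>S. c i * poly f (fst (P i))) = 0"
          using B rs by (intro power_sums_zero_imp_poly_sum_zero[of k]) auto
        moreover have "(\<Sum>i\<in>S. c i * poly f (fst (P i))) = (\<Sum>i\<in>S. c i * (fst (P i) ^ r * snd (P i) ^ s))"
          by (intro sum.cong) (auto simp: f_def poly_monom y algebra_simps)
        ultimately show "(\<Sum>i\<in>S. c i * (fst (P i) ^ r * snd (P i) ^ s)) = 0" by simp
      qed
    qed
    ultimately show ?thesis by blast
  qed
  then obtain u where u: "inj_on u S"
    "\<And>c. (\<forall>r s. r + s \<le> k \<longrightarrow> (\<Sum>i\<in>S. c i * (fst (P i) ^ r * snd (P i) ^ s)) = 0)
      \<longleftrightarrow> (\<forall>j\<le>k. (\<Sum>i\<in>S. c i * u i ^ j) = 0)" by blast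
  show thesis
  proof (rule power_sums_zero_iff[OF \<open>finite S\<close> u(1) card])
    fix w
    assume w: "\<And>i. i \<in> S \<Longrightarrow> w i \<noteq> 0"
      "\<And>c. (\<forall>j\<le>k. (\<Sum>i\<in>S. c i * u i ^ j) = 0) \<longleftrightarrow> (\<exists>l. \<forall>i\<in>S. c i = l * w i)"
    show thesis by (rule that[of w]) (simp_all only: w not_False_eq_True u(2))
  qed
qed

section \<open>Trace and norm of the quadratic extension\<close>

text \<open>The fibers partition \<open>A\<close>. With at most \<open>b\<close> fibers of size at
  most \<open>a\<close>, the total \<open>a * b\<close> is reached only if every fiber is full. For
  trace and norm this turns bounds on numbers of roots into exact counts.\<close>

lemma card_fiber_eq:
  assumes "finite A" "finite B" and f: "\<And>x. x \<in> A \<Longrightarrow> f x \<in> B"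
    and "card B \<le> b" and card: "card A = a * b"
    and le: "\<And>t. t \<in> B \<Longrightarrow> card {x \<in> A. f x = t} \<le> a"
    and t: "t \<in> B"
  shows "card {x \<in> A. f x = t} = a"
proof (rule ccontr)
  assume "card {x \<in> A. f x = t} \<noteq> a"
  hence less: "card {x \<in> A. f x = t} < a" using le[OF t] by simp
  have "card A = (\<Sum>t\<in>B. card {x \<in> A. f x = t})"
    using sum.group[OF \<open>finite A\<close> \<open>finite B\<close>, of f "\<lambda>_. 1 :: nat"] f by (auto simp: image_subset_iff)
  also have "\<dots> < (\<Sum>t\<in>B. a)"
    using le less t \<open>finite B\<close> by (intro sum_strict_mono_ex1) auto
  also have "\<dots> \<le> a * b" using \<open>card B \<le> b\<close> by (simp add: mult.commute)
  finally show False using card by simp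
qed

lemma card_power_eq_poly_le:
  fixes r :: "'a::idom poly"
  assumes "degree r < k"
  shows "card {x. x ^ k = poly r x} \<le> k"
proof -
  define f where "f = monom 1 k - r"
  have "coeff f k = 1" using assms by (simp add: f_def coeff_eq_0)
  hence "f \<noteq> 0" by auto
  moreover have "degree f \<le> k"
    unfolding f_def using assms by (intro degree_diff_le degree_monom_le) auto
  moreover have "{x. x ^ k = poly r x} = {x. poly f x = 0}"
    by (simp add: f_def poly_monom)
  ultimately show ?thesis using card_poly_roots_bound[of f] by simp
qed

text \<open>Multiplication by a nonzero \<open>x\<close> permutes the units, so comparing the
  products of all units gives the claim; the extra factor \<open>x\<close> raises the exponent from
  the number of units to the size of the field.\<close>

lemma power_card_UNIV:
  fixes x :: "'a::{field, finite}"
  shows "x ^ CARD('a) = x"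
proof (cases "x = 0")
  case False
  have "x * (\<Prod>y\<in>UNIV - {0}. x * y) = x * x ^ (CARD('a) - 1) * \<Prod>(UNIV - {0})"
    by (simp add: prod.distrib mult_ac)
  also have "(\<Prod>y\<in>UNIV - {0}. x * y) = (\<Prod>y\<in>UNIV - {0}. y)"
    by (rule prod.reindex_bij_witness[of _ "\<lambda>y. y / x" "\<lambda>y. x * y"]) (use False in auto)
  also have "x * x ^ (CARD('a) - 1) = x ^ CARD('a)"
    using zero_less_card_finite[where 'a = 'a] by (subst power_Suc[symmetric]) simp
  finally show ?thesis by simp
qed (simp add: power_0_left)

text \<open>Translation by 1 permutes the ring, so adding 1 to every element leaves the sum of all
  elements unchanged.\<close>

lemma CHAR_dvd_card_UNIV: "CHAR('a::{ring_1, finite}) dvd CARD('a)"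
proof -
  have "(\<Sum>x\<in>(UNIV :: 'a set). x + 1) = (\<Sum>x\<in>UNIV. x)"
    by (rule sum.reindex_bij_witness[of _ "\<lambda>x. x - 1" "\<lambda>x. x + 1"]) auto
  hence "of_nat CARD('a) = (0 :: 'a)" by (simp add: sum.distrib)
  thus ?thesis by (simp only: of_nat_eq_0_iff_char_dvd)
qed

lemma prime_CHAR_finite_field: "prime CHAR('a::{field, finite})"
  using prime_CHAR_semidom[where ?'a = 'a] finite_imp_CHAR_pos[where ?'a = 'a] by simp

context
  fixes q :: nat and ty :: "'a::{field, finite} itself"
  assumes q: "primepow q" and card: "CARD('a) = q\<^sup>2"
begin

private lemma q_gt_1: "q > 1"
  using primepow_gt_Suc_0[OF q] by simp

text \<open>The characteristic is a prime dividing \<open>q^2\<close>, a power of \<open>p\<close>,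
  hence it equals \<open>p\<close>. So \<open>q\<close> is a power of the characteristic.\<close>

private lemma frobenius_add: "(x + y :: 'a) ^ q = x ^ q + y ^ q"
proof -
  obtain p k where pk: "prime p" "q = p ^ k" using q by (auto simp: primepow_def)
  have "CHAR('a) dvd p ^ (k * 2)"
    using CHAR_dvd_card_UNIV[where ?'a = 'a] by (simp add: card pk power_mult)
  hence "CHAR('a) = p"
    using prime_CHAR_finite_field[where ?'a = 'a] pk(1)
    by (metis prime_dvd_power primes_dvd_imp_eq)
  thus ?thesis
    using freshmans_dream'[where ?'a = 'a, of q k] pk prime_CHAR_finite_field[where ?'a = 'a] by simp
qed

private lemma frobenius_diff: "(x - y :: 'a) ^ q = x ^ q - y ^ q"
  using frobenius_add[of "x - y" y] by (simp add: algebra_simps)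

text \<open>Raising to the power \<open>q\<close> is the conjugation of the quadratic extension;
  traces and norms are fixed by it.\<close>

private lemma frobenius_twice: "((x :: 'a) ^ q) ^ q = x"
  using power_card_UNIV[of x] by (simp add: card power2_eq_square power_mult)

text \<open>The trace sends \<open>q^2\<close> elements to the at most \<open>q\<close> fixed points
  of conjugation, and each fiber consists of roots of a polynomial of degree \<open>q\<close>, so
  \<open>card_fiber_eq\<close> applies.\<close>

lemma card_trace_fiber:
  fixes t :: 'a
  assumes "t ^ q = t"
  shows "card {y. y ^ q + y = t} = q"
proof -
  have "card {y \<in> UNIV. y ^ q + y = t} = q"
  proof (rule card_fiber_eq[where B = "{t :: 'a. t ^ q = t}" and b = q])
    show "card {t :: 'a. t ^ q = t} \<le> q"
      using card_power_eq_poly_le[of "[:0, 1 :: 'a:]" q] q_gt_1 by simp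
    show "card {y \<in> UNIV. y ^ q + y = s} \<le> q" for s :: 'a
      using card_power_eq_poly_le[of "[:s, - 1:]" q] q_gt_1
      by (simp add: algebra_simps eq_diff_eq)
  qed (auto simp: card assms frobenius_add frobenius_twice power2_eq_square)
  thus ?thesis by simp
qed

text \<open>The norm sends the \<open>q^2 - 1 = (q + 1) * (q - 1)\<close> units to the at most
  \<open>q - 1\<close> nonzero fixed elements, with fibers of size at most \<open>q + 1\<close>.
  Zero is left out because its fiber is a single point.\<close>

lemma card_norm_fiber:
  fixes t :: 'a
  assumes t: "t ^ q = t" "t \<noteq> 0"
  shows "card {x. x ^ (q + 1) = t} = q + 1"
proof -
  \<comment> \<open>For nonzero elements, being fixed by conjugation is rewritten as an equation of
    degree \<open>q - 1\<close>, so that the root bound excludes zero.\<close>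
  have unit: "s ^ (q - 1) = 1 \<longleftrightarrow> s ^ q = s" if "s \<noteq> 0" for s :: 'a
    using that q_gt_1 power_minus_mult[of q s] by (metis mult_cancel_right1 mult_cancel_right2 less_trans zero_less_one mult.commute)
  have "card {x \<in> UNIV - {0}. x ^ (q + 1) = t} = q + 1"
  proof (rule card_fiber_eq[where B = "{t :: 'a. t ^ (q - 1) = 1}" and b = "q - 1"])
    show "card {t :: 'a. t ^ (q - 1) = 1} \<le> q - 1"
      using card_power_eq_poly_le[of "[:1 :: 'a:]" "q - 1"] q_gt_1 by simp
    show "card {y \<in> UNIV - {0}. y ^ (q + 1) = s} \<le> q + 1" for s :: 'a
      using card_power_eq_poly_le[of "[:s:]" "q + 1"]
        card_mono[of "{y. y ^ (q + 1) = s}" "{y \<in> UNIV - {0}. y ^ (q + 1) = s}"]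
      by (fastforce intro: order_trans)
    show "card (UNIV - {0 :: 'a}) = (q + 1) * (q - 1)"
      using q_gt_1 by (simp add: card card_Diff_subset power2_eq_square algebra_simps)
    show "x ^ (q + 1) \<in> {t. t ^ (q - 1) = 1}" if "x \<in> UNIV - {0}" for x :: 'a
      using that unit[of "x ^ (q + 1)"] by (simp add: power_mult_distrib frobenius_twice mult.commute)
  qed (use t unit in auto)
  moreover have "{x \<in> UNIV - {0}. x ^ (q + 1) = t} = {x. x ^ (q + 1) = t}"
    using t by auto
  ultimately show ?thesis by simp
qed

section \<open>Intersections of lines with the Hermitian curve\<close>

lemma card_hermitian_vertical_line:
  "card (hermitian_points q \<inter> vertical_line (a :: 'a)) = q"
proof -
  have "hermitian_points q \<inter> vertical_line a = Pair a ` {y. y ^ q + y = a ^ (q + 1)}"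
    by (auto simp: hermitian_points_def vertical_line_def)
  moreover have "(a ^ (q + 1)) ^ q = a ^ (q + 1)"
    by (simp add: power_mult_distrib frobenius_twice mult.commute)
  ultimately show ?thesis
    using card_trace_fiber[of "a ^ (q + 1)"] by (simp add: card_image inj_on_def)
qed

text \<open>
  Substituting \<open>x = z + b^q\<close> turns the equation of the curve on the line \<open>y = b x + e\<close> into
  \<open>z^(q+1) = b^(q+1) + e^q + e\<close>, a norm equation.
\<close>

lemma card_hermitian_sloped_line:
  fixes b e :: 'a
  shows "card (hermitian_points q \<inter> sloped_line (b, e)) =
    (if b ^ (q + 1) + e ^ q + e = 0 then 1 else q + 1)"
proof -
  define t where "t = b ^ (q + 1) + e ^ q + e"
  have "(z + b ^ q) ^ (q + 1) = (b * (z + b ^ q) + e) ^ q + (b * (z + b ^ q) + e) \<longleftrightarrow> z ^ (q + 1) = t"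
    for z
  proof -
    have "(z + b ^ q) ^ (q + 1) = (z + b ^ q) * (z ^ q + b)"
      by (simp add: frobenius_add frobenius_twice)
    moreover have "(b * (z + b ^ q) + e) ^ q = b ^ q * (z ^ q + b) + e ^ q"
      by (simp add: frobenius_add frobenius_twice power_mult_distrib)
    ultimately show ?thesis by (simp add: t_def algebra_simps)
  qed
  hence "hermitian_points q \<inter> sloped_line (b, e) =
      (\<lambda>z. (z + b ^ q, b * (z + b ^ q) + e)) ` {z. z ^ (q + 1) = t}"
    by (force simp: hermitian_points_def sloped_line_def image_iff intro: exI[of _ "_ - b ^ q"])
  hence "card (hermitian_points q \<inter> sloped_line (b, e)) = card {z. z ^ (q + 1) = t}"
    by (simp add: card_image inj_on_def)
  also have "\<dots> = (if t = 0 then 1 else q + 1)"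
  proof (cases "t = 0")
    case True
    hence "{z. z ^ (q + 1) = t} = {0}" by auto
    thus ?thesis using True by simp
  next
    case False
    \<comment> \<open>\<open>t\<close> is a norm plus a trace.\<close>
    have "t ^ q = t"
      by (simp add: t_def frobenius_add frobenius_twice power_mult_distrib algebra_simps)
    thus ?thesis using False card_norm_fiber by simp
  qed
  finally show ?thesis by (simp add: t_def)
qed

text \<open>For each of the \<open>q^2\<close> slopes \<open>b\<close>, the intercepts form the
  trace fiber over the negated norm of \<open>b\<close>, which has \<open>q\<close>
  elements.\<close>

lemma card_tangent_lines: "card {(b, e :: 'a). b ^ (q + 1) + e ^ q + e = 0} = q ^ 3"
proof -
  have "card {e :: 'a. b ^ (q + 1) + e ^ q + e = 0} = q" for b
  proof -
    have minus_q: "(- x) ^ q = - (x ^ q)" for x :: 'a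
      using frobenius_diff[of 0 x] q_gt_1 by (simp add: power_0_left)
    have "{e. b ^ (q + 1) + e ^ q + e = 0} = {e. e ^ q + e = - (b ^ (q + 1))}"
      by (simp add: eq_neg_iff_add_eq_0 algebra_simps)
    moreover have "(- (b ^ (q + 1))) ^ q = - (b ^ (q + 1))"
      unfolding minus_q by (simp add: power_mult_distrib frobenius_twice mult.commute)
    ultimately show ?thesis using card_trace_fiber by simp
  qed
  moreover have "{(b, e :: 'a). b ^ (q + 1) + e ^ q + e = 0} =
      (SIGMA b:UNIV. {e. b ^ (q + 1) + e ^ q + e = 0})" by auto
  ultimately show ?thesis by (simp add: card_SigmaI card power3_eq_cube power2_eq_square)
qed

lemma sum_choose_hermitian_lines:
  assumes "2 \<le> d"
  shows "(\<Sum>L\<in>affine_lines. card (hermitian_points q \<inter> (L :: ('a \<times> 'a) set)) choose d) =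
    q\<^sup>2 * (q choose d) + (q ^ 4 - q ^ 3) * (Suc q choose d)"
proof -
  define T where "T = {(b, e :: 'a). b ^ (q + 1) + e ^ q + e = 0}"
  have "card T = q ^ 3" unfolding T_def by (rule card_tangent_lines)
  hence "card (- T) = q ^ 4 - q ^ 3"
    by (simp add: Compl_eq_Diff_UNIV card_Diff_subset card card_prod flip: power_add)
  have "(\<Sum>L\<in>range vertical_line. card (hermitian_points q \<inter> (L :: ('a \<times> 'a) set)) choose d) =
      q\<^sup>2 * (q choose d)"
    by (subst sum.reindex[OF inj_vertical_line]) (simp add: card_hermitian_vertical_line card)
  moreover have "(\<Sum>L\<in>range sloped_line. card (hermitian_points q \<inter> (L :: ('a \<times> 'a) set)) choose d) =
      (q ^ 4 - q ^ 3) * (Suc q choose d)"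
  proof -
    have "(\<Sum>L\<in>range sloped_line. card (hermitian_points q \<inter> (L :: ('a \<times> 'a) set)) choose d) =
        (\<Sum>l\<in>UNIV. card (hermitian_points q \<inter> sloped_line (l :: 'a \<times> 'a)) choose d)"
      by (subst sum.reindex[OF inj_sloped_line]) simp
    \<comment> \<open>Tangent lines drop out: one point has no subset of size
      \<open>d \<ge> 2\<close>.\<close>
    also have "\<dots> = (\<Sum>l\<in>- T. Suc q choose d)"
    proof (rule sum.mono_neutral_cong_right)
      show "\<forall>l\<in>UNIV - - T. card (hermitian_points q \<inter> sloped_line l) choose d = 0"
        using assms by (auto simp: T_def card_hermitian_sloped_line)
    qed (auto simp: T_def card_hermitian_sloped_line)
    finally show ?thesis using \<open>card (- T) = q ^ 4 - q ^ 3\<close> by simp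
  qed
  ultimately show ?thesis
    unfolding affine_lines_def
    by (subst sum.union_disjoint) (auto simp: vertical_line_neq_sloped_line)
qed

end

section \<open>Words of minimum weight\<close>

lemma eval_at_xy_monom: "eval_at (xy_monom r s) p = fst p ^ r * snd p ^ s"
  by (simp add: eval_at_def xy_monom_def poly_monom poly_power)

text \<open>The bound \<open>k * (q + 1)\<close> is the weight of \<open>y^k\<close>, the heaviest
  monomial of degree \<open>k\<close>. The lightest one of degree \<open>k + 1\<close> is
  \<open>x^(k+1)\<close>, of weight \<open>q * k + q\<close>, which is larger because
  \<open>k < q\<close>.\<close>

lemma monomial_basis_corner:
  assumes "k + 2 \<le> q"
  shows "monomial_basis (int (k * (q + 1))) q = {xy_monom r s | r s. r + s \<le> k}"
proof -
  have "(int q * int r + (int q + 1) * int s \<le> int (k * (q + 1)) \<and> s \<le> q - 1 \<and> r \<le> q\<^sup>2 - 1)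
      \<longleftrightarrow> r + s \<le> k" (is "?A \<longleftrightarrow> _") for r s
  proof
    assume ?A
    hence "int (q * r + (q + 1) * s) \<le> int (k * (q + 1))" by (simp add: algebra_simps)
    hence le: "q * r + (q + 1) * s \<le> k * (q + 1)" by (simp only: of_nat_le_iff)
    show "r + s \<le> k"
    proof (rule ccontr)
      assume "\<not> r + s \<le> k"
      hence "q * (k + 1) \<le> q * (r + s)" by (intro mult_left_mono) auto
      also have "\<dots> \<le> q * r + (q + 1) * s" by (simp add: algebra_simps)
      finally show False using le assms by (simp add: algebra_simps)
    qed
  next
    assume rs: "r + s \<le> k"
    have "q * r + (q + 1) * s \<le> (r + s) * (q + 1)" by (simp add: algebra_simps)
    also have "\<dots> \<le> k * (q + 1)" using rs by (intro mult_right_mono) auto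
    finally have "int (q * r + (q + 1) * s) \<le> int (k * (q + 1))" by (simp only: of_nat_le_iff)
    moreover have "q \<le> q\<^sup>2" by (simp add: power2_eq_square)
    hence "s \<le> q - 1" "r \<le> q\<^sup>2 - 1" using rs assms by linarith+
    ultimately show ?A by (simp add: algebra_simps)
  qed
  thus ?thesis unfolding monomial_basis_def by simp
qed

text \<open>The code depends on \<open>m\<close> only through the set of monomials, so the
  description is unique; \<open>monomial_basis_corner\<close> supplies a suitable
  \<open>m\<close>.\<close>

lemma corner_code_eq:
  fixes P :: "nat \<Rightarrow> 'a::field \<times> 'a"
  assumes "2 \<le> d" "d \<le> q"
  shows "corner_code n P q d = {c \<in> {1..n} \<rightarrow>\<^sub>E UNIV.
    \<forall>r s. r + s \<le> d - 2 \<longrightarrow> (\<Sum>i = 1..n. c i * (fst (P i) ^ r * snd (P i) ^ s)) = 0}" (is "_ = ?C")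
proof -
  have C: "hermitian_code n P m q = ?C"
    if "(monomial_basis m q :: 'a poly poly set) = {xy_monom r s | r s. r + s \<le> d - 2}" for m
    unfolding hermitian_code_def that by (force simp: eval_at_xy_monom)
  have basis: "(monomial_basis (int ((d - 2) * (q + 1))) q :: 'a poly poly set) =
      {xy_monom r s | r s. r + s \<le> d - 2}"
    by (rule monomial_basis_corner) (use assms in simp)
  show ?thesis
    unfolding corner_code_def
  proof (rule the_equality)
    show "\<exists>m. (monomial_basis m q :: 'a poly poly set) = {xy_monom r s | r s. r + s \<le> d - 2} \<and>
        ?C = hermitian_code n P m q"
      using basis C[OF basis] by (intro exI conjI) (assumption, rule sym)
  next
    fix D
    assume "\<exists>m. (monomial_basis m q :: 'a poly poly set) = {xy_monom r s | r s. r + s \<le> d - 2} \<and>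
        D = hermitian_code n P m q"
    then obtain m where
      m: "(monomial_basis m q :: 'a poly poly set) = {xy_monom r s | r s. r + s \<le> d - 2}"
        "D = hermitian_code n P m q"
      by (elim exE conjE)
    show "D = ?C" unfolding m(2) by (rule C[OF m(1)])
  qed
qed

text \<open>The relations on collinear points are the multiples of one vector without zero entries,
  so the words with support exactly \<open>S\<close> correspond to the nonzero scalars.\<close>

lemma card_corner_code_support:
  fixes P :: "nat \<Rightarrow> 'a::{field, finite} \<times> 'a"
  assumes d: "2 \<le> d" "d \<le> q" and inj: "inj_on P {1..n}"
    and S: "S \<subseteq> {1..n}" "card S = d" and L: "L \<in> affine_lines" "P ` S \<subseteq> L"
  shows "card {c \<in> corner_code n P q d. {i \<in> {1..n}. c i \<noteq> 0} = S} = CARD('a) - 1"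
proof -
  have "finite S" using S finite_subset by blast
  have "inj_on P S" using inj S inj_on_subset by blast
  have card_S: "card S = Suc (Suc (d - 2))" using S d by simp
  obtain w where w: "\<And>i. i \<in> S \<Longrightarrow> w i \<noteq> 0"
    and eq: "\<And>c. (\<forall>r s. r + s \<le> d - 2 \<longrightarrow> (\<Sum>i\<in>S. c i * (fst (P i) ^ r * snd (P i) ^ s)) = 0)
              \<longleftrightarrow> (\<exists>l. \<forall>i\<in>S. c i = l * w i)"
    by (rule collinear_moments_zero_iff[OF \<open>finite S\<close> \<open>inj_on P S\<close> card_S L]) (rule that)
  \<comment> \<open>Inside \<open>{1..n}\<close> the word is zero off \<open>S\<close>; outside,
    \<open>restrict\<close> makes it \<open>undefined\<close>, as extensional words require.\<close>
  define word where "word l = restrict (\<lambda>i. if i \<in> S then l * w i else 0) {1..n}" for l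
  obtain i0 where i0: "i0 \<in> S" using S d by fastforce
  have sum_eq: "(\<Sum>i = 1..n. c i * f i) = (\<Sum>i\<in>S. c i * f i)"
    if "{i \<in> {1..n}. c i \<noteq> 0} = S" for c f :: "nat \<Rightarrow> 'a"
    using that by (intro sum.mono_neutral_right) auto
  have "{c \<in> corner_code n P q d. {i \<in> {1..n}. c i \<noteq> 0} = S} = word ` (UNIV - {0})"
  proof (intro equalityI subsetI)
    fix c assume c: "c \<in> {c \<in> corner_code n P q d. {i \<in> {1..n}. c i \<noteq> 0} = S}"
    hence supp: "{i \<in> {1..n}. c i \<noteq> 0} = S" by simp
    have "\<forall>r s. r + s \<le> d - 2 \<longrightarrow> (\<Sum>i\<in>S. c i * (fst (P i) ^ r * snd (P i) ^ s)) = 0"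
      using c unfolding corner_code_eq[OF d] sum_eq[OF supp, symmetric] by simp
    then obtain l where l: "\<forall>i\<in>S. c i = l * w i" using eq by blast
    have "l \<noteq> 0" using l i0 supp by auto
    moreover have "c = word l"
    proof
      fix i show "c i = word l i"
        using c l supp unfolding corner_code_eq[OF d] by (auto simp: word_def PiE_def extensional_def)
    qed
    ultimately show "c \<in> word ` (UNIV - {0})" by blast
  next
    fix c assume "c \<in> word ` (UNIV - {0})"
    then obtain l where l: "l \<noteq> 0" "c = word l" by blast
    have supp: "{i \<in> {1..n}. c i \<noteq> 0} = S"
      using l w S by (auto simp: word_def)
    have "\<forall>i\<in>S. c i = l * w i" using l S by (auto simp: word_def)
    hence "\<forall>r s. r + s \<le> d - 2 \<longrightarrow> (\<Sum>i = 1..n. c i * (fst (P i) ^ r * snd (P i) ^ s)) = 0"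
      unfolding sum_eq[OF supp] using eq by blast
    moreover have "c \<in> {1..n} \<rightarrow>\<^sub>E UNIV" using l by (simp add: word_def)
    ultimately show "c \<in> {c \<in> corner_code n P q d. {i \<in> {1..n}. c i \<noteq> 0} = S}"
      unfolding corner_code_eq[OF d] using supp by blast
  qed
  moreover have "inj word"
  proof (rule injI)
    fix l l' assume "word l = word l'"
    hence "word l i0 = word l' i0" by simp
    thus "l = l'" using i0 w S by (auto simp: word_def)
  qed
  ultimately show ?thesis
    by (simp add: card_image inj_on_subset card_Diff_subset)
qed

lemma corner_code_support_collinear:
  fixes P :: "nat \<Rightarrow> 'a::field \<times> 'a"
  assumes d: "2 \<le> d" "d \<le> q" and inj: "inj_on P {1..n}"
    and c: "c \<in> corner_code n P q d" "weight n c = d"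
  shows "\<exists>L\<in>affine_lines. P ` {i \<in> {1..n}. c i \<noteq> 0} \<subseteq> L"
proof (rule moments_zero_imp_collinear[where k = "d - 2" and c = c])
  fix r s assume "r + s \<le> d - 2"
  hence "(\<Sum>i = 1..n. c i * (fst (P i) ^ r * snd (P i) ^ s)) = 0"
    using c(1) by (simp add: corner_code_eq[OF d])
  also have "(\<Sum>i = 1..n. c i * (fst (P i) ^ r * snd (P i) ^ s)) =
      (\<Sum>i | i \<in> {1..n} \<and> c i \<noteq> 0. c i * (fst (P i) ^ r * snd (P i) ^ s))"
    by (intro sum.mono_neutral_right) auto
  finally show "\<dots> = 0" .
next
  show "inj_on P {i \<in> {1..n}. c i \<noteq> 0}" using inj by (rule inj_on_subset) auto
  show "card {i \<in> {1..n}. c i \<noteq> 0} = Suc (Suc (d - 2))"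
    using c(2) d by (simp add: weight_def)
qed auto

text \<open>After multiplication by \<open>d\<close>, both binomials become multiples of
  \<open>q choose (d - 1)\<close>, with factors \<open>q - d + 1\<close> and \<open>q + 1\<close>.
  The identity left is \<open>(q - d + 1) + (q^2 - q) * (q + 1) = q^3 - d + 1\<close>. If
  \<open>d - 1 > q\<close>, all binomials vanish.\<close>

lemma choose_lines_eq:
  assumes "1 \<le> d"
  shows "real (q\<^sup>2 * (q choose d) + (q ^ 4 - q ^ 3) * (Suc q choose d)) =
    (real q)\<^sup>2 * real (q choose (d - 1)) * ((real q ^ 3 - real d + 1) / real d)"
proof (cases "d - 1 \<le> q")
  case True
  obtain e where e: "d = Suc e" using assms by (cases d) auto
  define B where "B = real (q choose e)"
  have "Suc e * (q choose Suc e) = (q - e) * (q choose e)"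
    using binomial_absorb_comp[of q e] binomial_absorption[of e q]
    by (metis binomial_absorption binomial_absorb_comp diff_Suc_1)
  hence "real (Suc e * (q choose Suc e)) = real ((q - e) * (q choose e))" by (rule arg_cong)
  hence 1: "real d * real (q choose d) = (real q - real d + 1) * B"
    using True by (simp add: e B_def of_nat_diff algebra_simps)
  have "real (Suc e * (Suc q choose Suc e)) = real (Suc q * (q choose e))"
    by (rule arg_cong) (rule Suc_times_binomial)
  hence 2: "real d * real (Suc q choose d) = (real q + 1) * B"
    by (simp add: e B_def algebra_simps del: binomial_Suc_Suc)
  have "q ^ 3 \<le> q ^ 4" by (cases "q = 0") (auto intro: power_increasing)
  hence 3: "real (q ^ 4 - q ^ 3) = real q ^ 4 - real q ^ 3" by (simp add: of_nat_diff)
  have "real d * real (q\<^sup>2 * (q choose d) + (q ^ 4 - q ^ 3) * (Suc q choose d)) =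
      real q ^ 2 * (real d * real (q choose d)) + (real q ^ 4 - real q ^ 3) * (real d * real (Suc q choose d))"
    unfolding of_nat_add of_nat_mult of_nat_power 3
    by (simp add: algebra_simps del: binomial_Suc_Suc)
  also have "\<dots> = (real q)\<^sup>2 * B * (real q ^ 3 - real d + 1)"
    unfolding 1 2 by (simp add: algebra_simps power2_eq_square power3_eq_cube power4_eq_xxxx)
  finally show ?thesis
    using assms by (simp add: field_simps B_def e del: binomial_Suc_Suc)
qed (simp add: binomial_eq_0)

theorem theorem4p8:
  fixes q d n :: nat
    and P :: "nat \<Rightarrow> 'a::{field, finite} \<times> 'a"
  assumes "primepow q"
    and "CARD('a) = q\<^sup>2"
    and "2 \<le> d" and "d \<le> q"
    and "bij_betw P {1..n} (hermitian_points q)"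
  shows "real (card {c \<in> corner_code n P q d. weight n c = d}) =
           (real q)\<^sup>2 * ((real q)\<^sup>2 - 1) * real (q choose (d - 1)) * ((real q ^ 3 - real d + 1) / real d)"
proof -
  note d = \<open>2 \<le> d\<close> \<open>d \<le> q\<close>
  have inj: "inj_on P {1..n}" and img: "P ` {1..n} = hermitian_points q"
    using assms(5) by (auto simp: bij_betw_def)
  \<comment> \<open>Lines are pulled back to index sets: \<open>\<S>\<close> collects the collinear
    index sets of size \<open>d\<close>, and \<open>W S\<close> the words with support
    \<open>S\<close>.\<close>
  define I where "I L = {i \<in> {1..n}. P i \<in> L}" for L
  define \<S> where "\<S> = (\<Union>L\<in>affine_lines. {S. S \<subseteq> I L \<and> card S = d})"
  define W where "W S = {c \<in> corner_code n P q d. {i \<in> {1..n}. c i \<noteq> 0} = S}" for S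
  have fin_I: "finite (I L)" for L by (simp add: I_def)
  have card_I: "card (I L) = card (hermitian_points q \<inter> L)" for L
  proof -
    have "P ` I L = hermitian_points q \<inter> L" unfolding img[symmetric] by (auto simp: I_def)
    moreover have "inj_on P (I L)" using inj by (rule inj_on_subset) (auto simp: I_def)
    ultimately show ?thesis using card_image by metis
  qed
  have disj: "{S. S \<subseteq> I L \<and> card S = d} \<inter> {S. S \<subseteq> I L' \<and> card S = d} = {}"
    if "L \<in> affine_lines" "L' \<in> affine_lines" "L \<noteq> L'" for L L'
  proof (rule ccontr)
    assume "\<not> ?thesis"
    then obtain S where S: "S \<subseteq> I L" "S \<subseteq> I L'" "card S = d" by blast
    obtain i where i: "i \<in> S" using S d by fastforce
    \<comment> \<open>As \<open>d \<ge> 2\<close>, a common subset contains a second index, and two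
      distinct points determine the line.\<close>
    have "\<not> S \<subseteq> {i}" using S d card_mono[of "{i}" S] by auto
    then obtain j where j: "j \<in> S" "j \<noteq> i" by blast
    have ij: "i \<in> I L" "i \<in> I L'" "j \<in> I L" "j \<in> I L'" using i j S by auto
    hence "P i \<noteq> P j" using j(2) inj_onD[OF inj, of i j] by (auto simp: I_def)
    hence "L = L'"
      using ij by (intro affine_line_unique[OF that(1,2), of "P i" "P j"]) (simp_all add: I_def)
    thus False using that(3) by simp
  qed
  have "card \<S> = (\<Sum>L\<in>affine_lines. card (I L) choose d)"
    unfolding \<S>_def using disj
    by (subst card_UN_disjoint) (auto simp: fin_I n_subsets)
  hence card_S: "card \<S> = q\<^sup>2 * (q choose d) + (q ^ 4 - q ^ 3) * (Suc q choose d)"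
    using sum_choose_hermitian_lines[OF assms(1-3)] by (simp add: card_I)
  have fin_S: "finite \<S>" unfolding \<S>_def using fin_I by auto
  have card_W: "card (W S) = CARD('a) - 1" if S: "S \<in> \<S>" for S
  proof -
    obtain L where "L \<in> affine_lines" "S \<subseteq> I L" "card S = d"
      using S unfolding \<S>_def by blast
    thus ?thesis
      unfolding W_def by (intro card_corner_code_support[OF d inj]) (auto simp: I_def)
  qed
  have "{c \<in> corner_code n P q d. weight n c = d} = (\<Union>S\<in>\<S>. W S)"
  proof (intro equalityI subsetI)
    fix c assume c: "c \<in> {c \<in> corner_code n P q d. weight n c = d}"
    then obtain L where "L \<in> affine_lines" "P ` {i \<in> {1..n}. c i \<noteq> 0} \<subseteq> L"
      using corner_code_support_collinear[OF d inj] by blast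
    hence "{i \<in> {1..n}. c i \<noteq> 0} \<in> \<S>"
      using c unfolding \<S>_def by (intro UN_I[of L]) (auto simp: I_def weight_def)
    thus "c \<in> (\<Union>S\<in>\<S>. W S)" using c by (auto simp: W_def)
  qed (auto simp: W_def \<S>_def weight_def)
  also have "card \<dots> = (\<Sum>S\<in>\<S>. card (W S))"
  proof (rule card_UN_disjoint[OF fin_S])
    \<comment> \<open>Infinite sets have \<open>card\<close> equal to 0, so the positive value
      \<open>q^2 - 1\<close> already yields finiteness of \<open>W S\<close>.\<close>
    have "card (W S) > 0" if "S \<in> \<S>" for S
      using card_W[OF that] d power_mono[of 2 q 2] by (simp add: assms(2))
    thus "\<forall>S\<in>\<S>. finite (W S)" by (auto intro: card_ge_0_finite)
  qed (auto simp: W_def)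
  also have "\<dots> = card \<S> * (q\<^sup>2 - 1)" by (simp add: card_W assms(2))
  finally have "real (card {c \<in> corner_code n P q d. weight n c = d}) =
      real (card \<S>) * ((real q)\<^sup>2 - 1)"
    using d by (simp add: of_nat_diff)
  also have "real (card \<S>) = (real q)\<^sup>2 * real (q choose (d - 1)) * ((real q ^ 3 - real d + 1) / real d)"
    unfolding card_S using d by (intro choose_lines_eq) simp
  finally show ?thesis by (simp only: mult_ac)
qed

end
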